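(* Let $p$ be a non-proportional-provide pool and consider any trace of $p$. Consider an operation $(a^*, b^* ) \leftarrow p.\mathbf{reclaim}(t)$ in the trace, for some liquidity token portion $t$. Let $\Delta a, \Delta b$ be the values given as arguments in the earlier operation of the trace that produced $t$, i.e. the matching operation $t \leftarrow p.\mathbf{provide}(\Delta a, \Delta b)$ or $t \leftarrow p.\mathbf{init}(\Delta a, \Delta b)$. Then $$a^* b^* \geq \Delta a\, \Delta b .$$
   Context: A liquidity token portion is an object carrying a non-negative real number, its amount; portions produced by different operations are regarded as different objects even if their amounts coincide. A non-proportional-provide pool $p$ has a state consisting of a pair $(a,b)$ of positive reals (amounts of assets A and B held by the pool) and a positive real $z$ (the total amount of liquidity tokens minted and not burned). It is manipulated by the following operations. - $t \leftarrow p.\mathbf{init}(\Delta a,\Delta b)$, with $\Delta a,\Delta b>0$: sets $(a,b)=(\Delta a,\Delta b)$ and $z=1$, and returns a liquidity token portion $t$ of amount $1$. This must be the first operation and is performed exactly once. - $\Delta b \leftarrow p.\mathbf{swapAtoB}(\Delta a)$, with $\Delta a>0$: returns some negative real $\Delta b$ satisfying $(a+\Delta a)(b+\Delta b)\ge ab$, where $(a,b)$ is the current state; the state becomes $(a+\Delta a,b+\Delta b)$, with $z$ unchanged. (Any such $\Delta b$ is permitted; the inequality allows for a non-negative fee.) - $\Delta a \leftarrow p.\mathbf{swapBtoA}(\Delta b)$, with $\Delta b>0$: returns some negative real $\Delta a$ satisfying $(a+\Delta a)(b+\Delta b)\ge ab$; the state becomes $(a+\Delta a,b+\Delta b)$,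 with $z$ unchanged. - $t \leftarrow p.\mathbf{provide}(\Delta a,\Delta b)$, with $\Delta a,\Delta b\ge 0$ arbitrary: the state changes from $(a,b),z$ to $(a+\Delta a,b+\Delta b),\ z+m$, where $m=\epsilon z$ and $\epsilon=\sqrt{\frac{(a+\Delta a)(b+\Delta b)}{ab}}-1$, and a liquidity token portion $t$ of amount $m$ is returned. - $(a^*,b^* ) \leftarrow p.\mathbf{reclaim}(t)$, where $t$ is a liquidity token portion output by an earlier $\mathbf{provide}$ operation or by the $\mathbf{init}$ operation and not previously given as input to a $\mathbf{reclaim}$: permitted only if $m<z$, where $m$ is the amount of $t$. It returns $a^*=am/z$, $b^*=bm/z$, and the state changes from $(a,b),z$ to $(a-a^*,b-b^* ),\ z-m$. A trace of the pool is a sequence of operations on the pool, starting with an $\mathbf{init}$ operation and satisfying all of the constraints above. *)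

theory Defs
  imports Complex_Main
begin

text \<open>
  The identifier makes portions objects: two portions may be different and carry the same amount.
\<close>

datatype portion = Portion (ident: nat) (amount: real)

text \<open>
  An operation is recorded together with the values it returned.  In the swap operations the first
  argument is the input and the second one the output (a negative real).
\<close>

datatype operation =
    Init real real portion
  | SwapAtoB real real
  | SwapBtoA real real
  | Provide real real portion
  | Reclaim portion real real

definition minted :: "operation list \<Rightarrow> portion set" where
  "minted ops = {t. \<exists>\<Delta>a \<Delta>b. Init \<Delta>a \<Delta>b t \<in> set ops \<or> Provide \<Delta>a \<Delta>b t \<in> set ops}"

definition reclaimed :: "operation list \<Rightarrow> portion set" where
  "reclaimed ops = {t. \<exists>a' b'. Reclaim t a' b' \<in> set ops}"

text \<open>
  \<open>run ops a b z\<close>: the list \<open>ops\<close>, in chronological order, satisfies all constraints of the pool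
  and leads to the state \<open>(a, b), z\<close>.  The condition \<open>t \<notin> minted ops\<close> says that
  different operations return different portions.
\<close>

inductive run :: "operation list \<Rightarrow> real \<Rightarrow> real \<Rightarrow> real \<Rightarrow> bool" where
  init:
    "\<lbrakk>\<Delta>a > 0; \<Delta>b > 0; amount t = 1\<rbrakk>
      \<Longrightarrow> run [Init \<Delta>a \<Delta>b t] \<Delta>a \<Delta>b 1"
| swapAtoB:
    "\<lbrakk>run ops a b z; \<Delta>a > 0; \<Delta>b < 0; (a + \<Delta>a) * (b + \<Delta>b) \<ge> a * b\<rbrakk>
      \<Longrightarrow> run (ops @ [SwapAtoB \<Delta>a \<Delta>b]) (a + \<Delta>a) (b + \<Delta>b) z"
| swapBtoA:
    "\<lbrakk>run ops a b z; \<Delta>b > 0; \<Delta>a < 0; (a + \<Delta>a) * (b + \<Delta>b) \<ge> a * b\<rbrakk>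
      \<Longrightarrow> run (ops @ [SwapBtoA \<Delta>b \<Delta>a]) (a + \<Delta>a) (b + \<Delta>b) z"
| provide:
    "\<lbrakk>run ops a b z; \<Delta>a \<ge> 0; \<Delta>b \<ge> 0;
      \<epsilon> = sqrt ((a + \<Delta>a) * (b + \<Delta>b) / (a * b)) - 1; m = \<epsilon> * z;
      amount t = m; t \<notin> minted ops\<rbrakk>
      \<Longrightarrow> run (ops @ [Provide \<Delta>a \<Delta>b t]) (a + \<Delta>a) (b + \<Delta>b) (z + m)"
| reclaim:
    "\<lbrakk>run ops a b z; t \<in> minted ops; t \<notin> reclaimed ops; m = amount t; m < z;
      a' = a * m / z; b' = b * m / z\<rbrakk>
      \<Longrightarrow> run (ops @ [Reclaim t a' b']) (a - a') (b - b') (z - m)"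

definition trace :: "operation list \<Rightarrow> bool" where
  "trace ops \<longleftrightarrow> (\<exists>a b z. run ops a b z)"

text \<open>
  Positivity of the state is not imposed by the rules: it is an invariant, as is non-negativity of
  the amounts of the portions.
\<close>

lemma run_invariant:
  assumes "run ops a b z"
  shows "a > 0 \<and> b > 0 \<and> z > 0 \<and> (\<forall>t \<in> minted ops. amount t \<ge> 0)"
  using assms
proof induction
  case (init \<Delta>a \<Delta>b t)
  then show ?case by (auto simp: minted_def)
next
  case (swapAtoB ops a b z \<Delta>a \<Delta>b)
  then have "0 < (a + \<Delta>a) * (b + \<Delta>b)"
    by (metis less_le_trans mult_pos_pos)
  then have "0 < b + \<Delta>b"
    using swapAtoB by (simp add: zero_less_mult_iff)
  then show ?case using swapAtoB by (auto simp: minted_def)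
next
  case (swapBtoA ops a b z \<Delta>b \<Delta>a)
  then have "0 < (a + \<Delta>a) * (b + \<Delta>b)"
    by (metis less_le_trans mult_pos_pos)
  then have "0 < a + \<Delta>a"
    using swapBtoA by (simp add: zero_less_mult_iff)
  then show ?case using swapBtoA by (auto simp: minted_def)
next
  case (provide ops a b z \<Delta>a \<Delta>b \<epsilon> m t)
  have "a * b \<le> (a + \<Delta>a) * (b + \<Delta>b)"
    using provide by (intro mult_mono) auto
  then have "1 \<le> (a + \<Delta>a) * (b + \<Delta>b) / (a * b)"
    using provide by simp
  then have "0 \<le> \<epsilon>"
    using provide by (simp del: real_sqrt_divide)
  then have "0 \<le> m" using provide by simp
  moreover have "minted (ops @ [Provide \<Delta>a \<Delta>b t]) = insert t (minted ops)"
    by (auto simp: minted_def)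
  ultimately show ?case
    using provide.IH provide.hyps(2,3) \<open>amount t = m\<close> by simp
next
  case (reclaim ops a b z t m a' b')
  have "a * m < a * z" "b * m < b * z" using reclaim by simp_all
  then have "a' < a" "b' < b"
    using reclaim by (simp_all add: pos_divide_less_eq)
  then show ?case using reclaim by (auto simp: minted_def)
qed

end

(* Along a trace the ratio a b / z^2 never decreases: swaps do not decrease a b, while provide and
   reclaim keep the ratio constant. Reclaiming a portion of amount m yields a* b* = (a b / z^2) m^2,
   so it suffices to look at the moment when the portion is minted. There sqrt (a b) m / z equals
   sqrt ((a + \<Delta>a) (b + \<Delta>b)) - sqrt (a b), which is at least sqrt (\<Delta>a \<Delta>b) by Cauchy-Schwarz. *)

theory Submission
  imports Defs
begin

text \<open>After squaring, the cross term 2 sqrt(ab) sqrt(cd) regroups as 2 sqrt(ad) sqrt(bc),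
  which is at most ad + bc by AM-GM.\<close>

lemma sqrt_mult_superadditive:
  fixes a b c d :: real
  assumes "a \<ge> 0" "b \<ge> 0" "c \<ge> 0" "d \<ge> 0"
  shows "sqrt (a * b) + sqrt (c * d) \<le> sqrt ((a + c) * (b + d))"
proof (rule real_le_rsqrt)
  have "2 * (sqrt (a * b) * sqrt (c * d)) = 2 * (sqrt (a * d) * sqrt (b * c))"
    by (simp add: real_sqrt_mult)
  also have "\<dots> \<le> a * d + b * c"
    using arith_geo_mean_sqrt[of "a * d" "b * c"] assms by (simp add: real_sqrt_mult)
  finally show "(sqrt (a * b) + sqrt (c * d))\<^sup>2 \<le> (a + c) * (b + d)"
    using assms by (simp add: power2_sum algebra_simps)
qed

text \<open>Division-free chaining of d/m^2 \<le> p/z^2 \<le> p'/z'^2. In this form \<open>m\<close>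
  may be 0, as for a provide of nothing.\<close>

lemma product_bound_mono:
  fixes z z' p p' m d :: real
  assumes "d * z\<^sup>2 \<le> p * m\<^sup>2" "p * z'\<^sup>2 \<le> p' * z\<^sup>2" "z > 0"
  shows "d * z'\<^sup>2 \<le> p' * m\<^sup>2"
proof -
  have "d * z\<^sup>2 * z'\<^sup>2 \<le> p * m\<^sup>2 * z'\<^sup>2"
    using assms(1) by (intro mult_right_mono) auto
  also have "\<dots> = p * z'\<^sup>2 * m\<^sup>2" by simp
  also have "\<dots> \<le> p' * z\<^sup>2 * m\<^sup>2"
    using assms(2) by (intro mult_right_mono) auto
  finally have "(d * z'\<^sup>2) * z\<^sup>2 \<le> (p' * m\<^sup>2) * z\<^sup>2"
    by (simp add: mult_ac)
  then show ?thesis using \<open>z > 0\<close> by simp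
qed

text \<open>Here \<open>\<epsilon>\<close> is the relative growth of sqrt(ab), so sqrt(ab)
  \<open>\<epsilon>\<close> is its increment, and superadditivity bounds this from below by
  sqrt(\<open>\<Delta>a * \<Delta>b\<close>).\<close>

lemma provide_amount_bound:
  fixes a b z \<Delta>a \<Delta>b \<epsilon> :: real
  assumes "a > 0" "b > 0" "\<Delta>a \<ge> 0" "\<Delta>b \<ge> 0"
    and \<epsilon>: "\<epsilon> = sqrt ((a + \<Delta>a) * (b + \<Delta>b) / (a * b)) - 1"
  shows "(a + \<Delta>a) * (b + \<Delta>b) = a * b * (1 + \<epsilon>)\<^sup>2"
    and "\<Delta>a * \<Delta>b \<le> a * b * \<epsilon>\<^sup>2"
proof -
  have "(1 + \<epsilon>)\<^sup>2 = (a + \<Delta>a) * (b + \<Delta>b) / (a * b)"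
    unfolding \<epsilon> using assms(1-4) by simp
  then show 1: "(a + \<Delta>a) * (b + \<Delta>b) = a * b * (1 + \<epsilon>)\<^sup>2"
    using assms(1,2) by simp
  \<comment> \<open>The sign makes the square root of (1 + \<open>\<epsilon>\<close>)^2 equal to 1 +
    \<open>\<epsilon>\<close> itself.\<close>
  have "1 + \<epsilon> \<ge> 0"
    unfolding \<epsilon> using assms(1-4) by simp
  then have "sqrt ((a + \<Delta>a) * (b + \<Delta>b)) = sqrt (a * b) * (1 + \<epsilon>)"
    unfolding 1 by (simp add: real_sqrt_mult)
  then have "sqrt (\<Delta>a * \<Delta>b) \<le> sqrt (a * b) * \<epsilon>"
    using sqrt_mult_superadditive[of a b \<Delta>a \<Delta>b] assms(1-4) by (simp add: algebra_simps)
  then have "(sqrt (\<Delta>a * \<Delta>b))\<^sup>2 \<le> (sqrt (a * b) * \<epsilon>)\<^sup>2"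
    using assms(3,4) by (intro power_mono) auto
  then show "\<Delta>a * \<Delta>b \<le> a * b * \<epsilon>\<^sup>2"
    using assms(1-4) by (simp add: power_mult_distrib)
qed

text \<open>Induction on the run. The bound starts as an equality at \<open>Init\<close>, and no
  operation decreases ab / z^2. It covers every portion minted so far, reclaimed or not.\<close>

lemma run_amount_bound:
  assumes "run ops a b z"
    and "Provide \<Delta>a \<Delta>b t \<in> set ops \<or> Init \<Delta>a \<Delta>b t \<in> set ops"
  shows "\<Delta>a * \<Delta>b * z\<^sup>2 \<le> a * b * (amount t)\<^sup>2"
  using assms
proof (induction arbitrary: \<Delta>a \<Delta>b t)
  case (init \<Delta>a \<Delta>b t)
  then show ?case by auto
next
  case (swapAtoB ops a b z da db)
  then have "\<Delta>a * \<Delta>b * z\<^sup>2 \<le> a * b * (amount t)\<^sup>2" by simp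
  also have "\<dots> \<le> (a + da) * (b + db) * (amount t)\<^sup>2"
    using swapAtoB.hyps by (intro mult_right_mono) auto
  finally show ?case .
next
  case (swapBtoA ops a b z db da)
  then have "\<Delta>a * \<Delta>b * z\<^sup>2 \<le> a * b * (amount t)\<^sup>2" by simp
  also have "\<dots> \<le> (a + da) * (b + db) * (amount t)\<^sup>2"
    using swapBtoA.hyps by (intro mult_right_mono) auto
  finally show ?case .
next
  case (provide ops a b z da db \<epsilon> m s)
  have pos: "a > 0" "b > 0" "z > 0"
    using run_invariant[OF provide.hyps(1)] by auto
  note bound = provide_amount_bound[OF pos(1,2) provide.hyps(2-4)]
  have z: "z + m = z * (1 + \<epsilon>)" unfolding provide.hyps(5) by (simp add: algebra_simps)
  \<comment> \<open>Stated for the state before the provide, even when \<open>t\<close> is the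
    portion just minted; the transfer to the new state is then the same for old and new
    portions.\<close>
  have "\<Delta>a * \<Delta>b * z\<^sup>2 \<le> a * b * (amount t)\<^sup>2"
  proof (cases "Provide \<Delta>a \<Delta>b t \<in> set ops \<or> Init \<Delta>a \<Delta>b t \<in> set ops")
    case True
    then show ?thesis by (rule provide.IH)
  next
    case False
    then have eq: "\<Delta>a = da" "\<Delta>b = db" "amount t = \<epsilon> * z"
      using provide.prems provide.hyps by auto
    show ?thesis
      using mult_right_mono[OF bound(2), of "z\<^sup>2"] unfolding eq
      by (simp add: power_mult_distrib mult.assoc)
  qed
  moreover have "a * b * (z + m)\<^sup>2 \<le> (a + da) * (b + db) * z\<^sup>2"
    unfolding bound(1) z by (simp add: power_mult_distrib)
  ultimately show ?case using \<open>z > 0\<close> by (rule product_bound_mono)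
next
  case (reclaim ops a b z s m a' b')
  have "z > 0" using run_invariant[OF reclaim.hyps(1)] by auto
  \<comment> \<open>Both reserves shrink by the same factor as \<open>z\<close>, so ab / z^2 is
    unchanged.\<close>
  have "a - a' = a * ((z - m) / z)" "b - b' = b * ((z - m) / z)"
    using reclaim.hyps \<open>z > 0\<close> by (simp_all add: field_simps)
  then have "a * b * (z - m)\<^sup>2 \<le> (a - a') * (b - b') * z\<^sup>2"
    using \<open>z > 0\<close> by (simp add: power2_eq_square)
  moreover have "\<Delta>a * \<Delta>b * z\<^sup>2 \<le> a * b * (amount t)\<^sup>2"
    using reclaim.prems by (intro reclaim.IH) auto
  ultimately show ?case using \<open>z > 0\<close> by (metis product_bound_mono)
qed

text \<open>Rule inversion strips operations from the end one at a time; since \<open>xs\<close> is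
  nonempty, the initial \<open>Init\<close> is never the one stripped.\<close>

lemma run_appendD:
  assumes "run (xs @ ys) a b z" "xs \<noteq> []"
  shows "\<exists>a b z. run xs a b z"
  using assms
proof (induction ys arbitrary: a b z rule: rev_induct)
  case Nil
  then show ?case by auto
next
  case (snoc y ys)
  have "run ((xs @ ys) @ [y]) a b z" "xs @ ys \<noteq> []" using snoc.prems by simp_all
  then have "\<exists>a b z. run (xs @ ys) a b z"
    by cases auto
  then show ?case using snoc.IH snoc.prems(2) by blast
qed

theorem theorem2:
  fixes ops :: "operation list" and t :: portion
    and i j :: nat and \<Delta>a \<Delta>b a' b' :: real
  assumes "trace ops"
    and "j < length ops" and "ops ! j = Reclaim t a' b'"
    and "i < j" and "ops ! i = Provide \<Delta>a \<Delta>b t \<or> ops ! i = Init \<Delta>a \<Delta>b t"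
  shows "a' * b' \<ge> \<Delta>a * \<Delta>b"
proof -
  \<comment> \<open>The prefix ends with the reclaim itself, so inverting its last step exposes the
    state in which \<open>a'\<close> and \<open>b'\<close> are computed.\<close>
  obtain a1 b1 z1 where "run (take (Suc j) ops) a1 b1 z1"
    using assms(1,2) run_appendD[of "take (Suc j) ops" "drop (Suc j) ops"]
    unfolding trace_def append_take_drop_id by fastforce
  then have "run (take j ops @ [Reclaim t a' b']) a1 b1 z1"
    using assms(2,3) by (simp add: take_Suc_conv_app_nth)
  then obtain a b z where r: "run (take j ops) a b z"
    and a': "a' = a * amount t / z" and b': "b' = b * amount t / z"
    by cases auto
  have "z > 0" using run_invariant[OF r] by auto
  have "ops ! i \<in> set (take j ops)"
    using assms(2,4) by (auto simp: in_set_conv_nth)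
  then have "\<Delta>a * \<Delta>b * z\<^sup>2 \<le> a * b * (amount t)\<^sup>2"
    using assms(5) by (intro run_amount_bound[OF r]) auto
  then show ?thesis
    using \<open>z > 0\<close> unfolding a' b' by (simp add: field_simps power2_eq_square)
qed

end
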